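(* For every integer $n\ge 1$, $|\mathcal{S}_n(31;\,3\to 2)| = B_n$, where $B_n$ is the $n$-th Bell number.
   Context: $[n]=\{1,\dots,n\}$, and $\mathcal{S}_n$ is the set of permutations $\pi=\pi_1\pi_2\cdots\pi_n$ of $[n]$ in one-line notation. The permutation $\hat\pi$: for $\pi\in\mathcal{S}_n$, $\hat\pi\in\mathcal{S}_n$ is the permutation whose cycle form is obtained from the word $\pi_1\cdots\pi_n$ by inserting a left parenthesis before each left-to-right maximum (an entry larger than all entries to its left) and a right parenthesis immediately before the next left-to-right maximum, or at the end of the word. A cycle $(c_1,c_2,\dots,c_s)$ means $c_1\mapsto c_2\mapsto\cdots\mapsto c_s\mapsto c_1$. Example: if $\pi=2537164$ then $\hat\pi=(2)(53)(7164)$. Arrow patterns: an arrow pattern of size $k$ is a pair $(\nu;H)$ where $\nu=\nu_1\cdots\nu_m$ is a word of distinct positive integers, $H$ is a collection of arrows $b_i\to c_i$, and the set of all integers appearing in $\nu$ or $H$ is $[k]$. A permutation $\pi\in\mathcal{S}_n$ contains $(\nu;H)$ if there are a set $X=\{x_1<x_2<\cdots<x_k\}\subseteq[n]$ and indices $t_1<\cdots<t_m$ such that $\pi_{t_1}\pi_{t_2}\cdots\pi_{t_m}=x_{\nu_1}x_{\nu_2}\cdots x_{\nu_m}$ and $\hat\pi(x_{b_i})=x_{c_i}$ for every arrow $b_i\to c_i$ in $H$. Otherwise $\pi$ avoids $(\nu;H)$. $\mathcal{S}_n(\nu;H)$ is the set of permutations in $\mathcal{S}_n$ avoiding $(\nu;H)$.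 The Bell number $B_n$ is the number of set partitions of $[n]$. *)

theory Defs
  imports "HOL-Combinatorics.Combinatorics" "HOL-Library.Disjoint_Sets"
begin

text \<open>
  A permutation of \<open>[n] = {1..n}\<close> in one-line notation is an element of
  \<^term>\<open>permutations_of_set {1..n}\<close>.  List positions count from 0, entries from 1.
\<close>

definition lr_max :: "nat list \<Rightarrow> nat \<Rightarrow> bool" where
  "lr_max w i \<longleftrightarrow> i < length w \<and> (\<forall>j<i. w ! j < w ! i)"

definition cycle_words :: "nat list \<Rightarrow> nat list list" where
  "cycle_words w =
     map (\<lambda>i. map ((!) w) (i # takeWhile (\<lambda>j. \<not> lr_max w j) [Suc i..<length w]))
       (filter (lr_max w) [0..<length w])"

text \<open>
  The cycles are disjoint when the entries of \<open>w\<close> are distinct, so the order of composition is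
  immaterial; \<^term>\<open>cycle_of_list [c\<^sub>1, c\<^sub>2, c\<^sub>3]\<close> maps \<open>c\<^sub>1\<close> to \<open>c\<^sub>2\<close>, \<open>c\<^sub>2\<close> to \<open>c\<^sub>3\<close> and \<open>c\<^sub>3\<close> to \<open>c\<^sub>1\<close>.
\<close>

definition hat :: "nat list \<Rightarrow> nat \<Rightarrow> nat" where
  "hat w = foldr (\<lambda>c f. cycle_of_list c \<circ> f) (cycle_words w) id"

lemma cycle_words_example:
  "cycle_words [2, 5, 3, 7, 1, 6, 4] = [[2], [5, 3], [7, 1, 6, 4]]"
  by code_simp

lemma hat_example:
  "map (hat [2, 5, 3, 7, 1, 6, 4]) [1, 2, 3, 4, 5, 6, 7] = [6, 2, 5, 7, 3, 4, 1]"
  by code_simp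

text \<open>A pair \<open>(b, c)\<close> in the second component stands for the arrow \<open>b \<rightarrow> c\<close>.\<close>

type_synonym arrow_pattern = "nat list \<times> (nat \<times> nat) set"

definition letters :: "arrow_pattern \<Rightarrow> nat set" where
  "letters p = set (fst p) \<union> fst ` snd p \<union> snd ` snd p"

definition pattern_size :: "arrow_pattern \<Rightarrow> nat" where
  "pattern_size p = card (letters p)"

definition is_arrow_pattern :: "arrow_pattern \<Rightarrow> bool" where
  "is_arrow_pattern p \<longleftrightarrow>
     distinct (fst p) \<and> finite (letters p) \<and> letters p = {1..pattern_size p}"

text \<open>
  The set \<open>X = {x\<^sub>1 < \<dots> < x\<^sub>k}\<close> is given by its increasing enumeration \<open>x\<close>, and the indices
  \<open>t\<^sub>1 < \<dots> < t\<^sub>m\<close> by an increasing function \<open>t\<close> on \<open>{0..<m}\<close>.  If \<open>w\<close> is a permutation of \<open>{1..n}\<close>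
  then \<^term>\<open>set w\<close> is \<open>{1..n}\<close>.
\<close>

definition contains_pattern :: "nat list \<Rightarrow> arrow_pattern \<Rightarrow> bool" where
  "contains_pattern w p \<longleftrightarrow>
     (\<exists>x t. strict_mono_on {1..pattern_size p} x \<and> x ` {1..pattern_size p} \<subseteq> set w \<and>
        strict_mono_on {0..<length (fst p)} t \<and>
        (\<forall>i<length (fst p). t i < length w \<and> w ! t i = x (fst p ! i)) \<and>
        (\<forall>(b, c)\<in>snd p. hat w (x b) = x c))"

definition avoiders :: "nat \<Rightarrow> arrow_pattern \<Rightarrow> nat list set" where
  "avoiders n p = {w \<in> permutations_of_set {1..n}. \<not> contains_pattern w p}"

definition Bell :: "nat \<Rightarrow> nat" where
  "Bell n = card {P. partition_on {1..n} P}"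

lemma is_arrow_pattern_31_32: "is_arrow_pattern ([3, 1], {(3, 2)})"
  and pattern_size_31_32: "pattern_size ([3, 1], {(3, 2)}) = 3"
  by (auto simp: is_arrow_pattern_def pattern_size_def letters_def)

end

theory Submission
  imports Defs
begin

text \<open>
  An arrow from \<open>c\<close> to a smaller value \<open>b\<close> in the cycle form means precisely that \<open>c b\<close> is a descent
  of the word: inside a cycle \<open>hat w\<close> moves one step to the right, and the last entry of a cycle is
  sent to the left-to-right maximum that opens it.  Hence a word avoids \<open>(31; 3 \<rightarrow> 2)\<close> iff each
  descent bottom is smaller than everything to its right.  In such a word \<open>u m v\<close> with least entry
  \<open>m\<close>, the part \<open>u\<close> is increasing and \<open>v\<close> is an arbitrary avoiding word, so the set of entries of
  \<open>u m\<close> plays the role of the block of \<open>m\<close> in a set partition.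
\<close>

section \<open>The cycle form of a word\<close>

lemma takeWhile_upt:
  obtains e where "takeWhile P [a..<b] = [a..<e]"
proof (cases "a \<le> b")
  case True
  let ?k = "length (takeWhile P [a..<b])"
  have "takeWhile P [a..<b] = take ?k [a..<b]"
    by (rule takeWhile_eq_take)
  also have "\<dots> = [a..<a + ?k]"
    using True length_takeWhile_le[of P "[a..<b]"] by (intro take_upt) simp
  finally show thesis by (rule that)
next
  case False
  then show thesis by (intro that[of a]) simp
qed

lemma set_takeWhile_upt:
  "j \<in> set (takeWhile P [a..<b]) \<longleftrightarrow> a \<le> j \<and> j < b \<and> (\<forall>k. a \<le> k \<and> k \<le> j \<longrightarrow> P k)"
proof (induction b)
  case (Suc b)
  show ?case
  proof (cases "a \<le> b")
    case True
    note a = True and IH = Suc.IH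
    show ?thesis
    proof (cases "\<forall>k\<in>{a..<b}. P k")
      case True
      with a show ?thesis by (auto simp: takeWhile_append le_less_Suc_eq less_Suc_eq le_less)
    next
      \<comment> \<open>A failure of \<open>P\<close> before \<open>b\<close> ends the scan, so the
        new index \<open>b\<close> affects neither side.\<close>
      case False
      then obtain k where "a \<le> k" "k < b" "\<not> P k" by auto
      then have "\<not> (\<forall>k. a \<le> k \<and> k \<le> b \<longrightarrow> P k)" by (meson less_imp_le_nat)
      with False a IH show ?thesis by (auto simp: takeWhile_append less_Suc_eq)
    qed
  qed simp
qed simp

text \<open>Cycles are recorded by positions instead of entries: each then becomes an interval of
  indices, and moving along a cycle is index arithmetic.\<close>

definition block :: "nat list \<Rightarrow> nat \<Rightarrow> nat list" where
  "block w i = i # takeWhile (\<lambda>j. \<not> lr_max w j) [Suc i..<length w]"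

lemma cycle_words_block:
  "cycle_words w = map (\<lambda>i. map ((!) w) (block w i)) (filter (lr_max w) [0..<length w])"
  by (simp add: cycle_words_def block_def)

lemma set_block:
  "s < length w \<Longrightarrow>
     j \<in> set (block w s) \<longleftrightarrow> s \<le> j \<and> j < length w \<and> (\<forall>k. s < k \<and> k \<le> j \<longrightarrow> \<not> lr_max w k)"
  unfolding block_def by (auto simp: set_takeWhile_upt Suc_le_eq le_less[of s j])

lemma block_upt:
  obtains e where "block w s = [s..<e]" "s < e"
proof -
  obtain e where e: "takeWhile (\<lambda>j. \<not> lr_max w j) [Suc s..<length w] = [Suc s..<e]"
    by (rule takeWhile_upt)
  show thesis
  proof (rule that)
    \<comment> \<open>When the tail is empty, \<open>e\<close> may be anything up to
      \<open>Suc s\<close>; the maximum keeps \<open>s\<close> itself in the interval.\<close>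
    show "block w s = [s..<max (Suc s) e]"
      by (cases "Suc s \<le> e") (simp_all add: block_def e upt_rec[of s] max_def)
  qed simp
qed

text \<open>If \<open>s < s'\<close>, then \<open>s'\<close> would be a left-to-right maximum after
  \<open>s\<close> and not beyond \<open>j\<close>, which the block of \<open>s\<close> excludes;
  likewise with the roles exchanged.\<close>

lemma block_disjoint:
  assumes "lr_max w s" "lr_max w s'" "j \<in> set (block w s)" "j \<in> set (block w s')"
  shows "s = s'"
proof -
  have "s < length w" "s' < length w"
    using assms by (auto simp: lr_max_def)
  with assms show ?thesis
    by (metis linorder_neqE_nat set_block)
qed

lemma ex_block:
  assumes "i < length w"
  obtains s where "lr_max w s" "i \<in> set (block w s)"
proof -
  let ?P = "\<lambda>s. lr_max w s \<and> s \<le> i"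
  \<comment> \<open>The block containing \<open>i\<close> opens at the last left-to-right maximum at
    or before \<open>i\<close>; position 0 shows that there is one.\<close>
  define s where "s = Greatest ?P"
  have "?P 0" using assms by (auto simp: lr_max_def)
  then have s: "?P s" "\<And>k. ?P k \<Longrightarrow> k \<le> s"
    unfolding s_def by (rule GreatestI_nat[where b = i], simp) (rule Greatest_le_nat[where b = i], auto)
  then have "i \<in> set (block w s)"
    using assms by (subst set_block) (auto simp: not_le[symmetric])
  with s that show thesis by blast
qed

text \<open>A position of the block after \<open>s\<close> is no left-to-right maximum, so some
  earlier entry is at least as large; descending in this way ends at or before \<open>s\<close>,
  where \<open>w ! s\<close> dominates.\<close>

lemma block_le_first:
  assumes "lr_max w s" "i \<in> set (block w s)"
  shows "w ! i \<le> w ! s"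
proof -
  have s: "s < length w" using assms by (simp add: lr_max_def)
  have i: "s \<le> i" "i < length w" and no: "\<And>k. s < k \<Longrightarrow> k \<le> i \<Longrightarrow> \<not> lr_max w k"
    using assms set_block[OF s] by auto
  have "k \<le> i \<Longrightarrow> w ! k \<le> w ! s" for k
  proof (induction k rule: less_induct)
    case (less k)
    show ?case
    proof (cases "k \<le> s")
      case True
      then show ?thesis using assms(1) by (auto simp: lr_max_def le_less)
    next
      case False
      then obtain j where "j < k" "w ! k \<le> w ! j"
        using no[of k] less.prems i by (auto simp: lr_max_def not_less)
      with less show ?thesis by (meson le_trans less_imp_le_nat)
    qed
  qed
  then show ?thesis by simp
qed

section \<open>Evaluating the product of disjoint cycles\<close>

lemma foldr_cycle_of_list_notin:
  "\<forall>c\<in>set cs. x \<notin> set c \<Longrightarrow> foldr (\<lambda>c f. cycle_of_list c \<circ> f) cs id x = x"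
  by (induction cs) (auto simp: id_outside_supp)

lemma cycle_of_list_in: "x \<in> set c \<Longrightarrow> cycle_of_list c x \<in> set c"
  by (metis bij_betw_apply cycle_permutes permutes_imp_bij)

text \<open>Cycles later in the list act first and fix \<open>x\<close>; those earlier in the list
  act afterwards and fix its image, which stays in \<open>set (f i)\<close>.\<close>

lemma foldr_cycle_of_list_in:
  assumes "x \<in> set (f i)" "i \<in> set is" "distinct is"
    and "\<And>j. j \<in> set is \<Longrightarrow> j \<noteq> i \<Longrightarrow> set (f j) \<inter> set (f i) = {}"
  shows "foldr (\<lambda>c g. cycle_of_list c \<circ> g) (map f is) id x = cycle_of_list (f i) x"
  using assms
proof (induction "is")
  case (Cons k "is")
  let ?F = "\<lambda>is. foldr (\<lambda>c g. cycle_of_list c \<circ> g) (map f is) id x"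
  have step: "?F (k # is) = cycle_of_list (f k) (?F is)" by simp
  show ?case
  proof (cases "k = i")
    case True
    then have "\<forall>c\<in>set (map f is). x \<notin> set c"
      using Cons.prems by fastforce
    then have "?F is = x" by (rule foldr_cycle_of_list_notin)
    then have "?F (k # is) = cycle_of_list (f k) x" unfolding step by (rule arg_cong)
    with True show ?thesis by (simp only:)
  next
    case False
    have "?F is = cycle_of_list (f i) x"
      by (rule Cons.IH) (use Cons.prems False in auto)
    moreover have "cycle_of_list (f i) x \<notin> set (f k)"
      using Cons.prems(1) Cons.prems(4)[of k] False cycle_of_list_in by fastforce
    ultimately show ?thesis unfolding step by (metis id_outside_supp)
  qed
qed simp

lemma hat_block:
  assumes w: "distinct w" and s: "lr_max w s" and i: "i \<in> set (block w s)"
  shows "hat w (w ! i) = cycle_of_list (map ((!) w) (block w s)) (w ! i)"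
  unfolding hat_def cycle_words_block
proof (rule foldr_cycle_of_list_in)
  show "s \<in> set (filter (lr_max w) [0..<length w])"
    using s by (auto simp: lr_max_def)
  fix j assume j: "j \<in> set (filter (lr_max w) [0..<length w])" "j \<noteq> s"
  then have "set (block w j) \<inter> set (block w s) = {}"
    using block_disjoint s by auto
  \<comment> \<open>Injectivity of indexing carries disjointness from sets of positions to sets of
    entries.\<close>
  moreover have "inj_on ((!) w) {..<length w}"
    using w by (auto simp: inj_on_def nth_eq_iff_index_eq)
  moreover have "set (block w j) \<subseteq> {..<length w}" "set (block w s) \<subseteq> {..<length w}"
    using j s set_block by (auto simp: lr_max_def)
  ultimately show "set (map ((!) w) (block w j)) \<inter> set (map ((!) w) (block w s)) = {}"
    by (simp add: inj_on_image_Int[symmetric])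
qed (use i in auto)

lemma cycle_of_list_nth:
  assumes "distinct c" "k < length c"
  shows "cycle_of_list c (c ! k) = c ! (Suc k mod length c)"
proof -
  have "map (cycle_of_list c) c = rotate1 c"
    using cyclic_rotation[OF assms(1), of 1] by simp
  then have "map (cycle_of_list c) c ! k = rotate1 c ! k" by simp
  with assms show ?thesis by (simp add: nth_rotate1)
qed

lemma hat_cases:
  assumes w: "distinct w" and s: "lr_max w s" and i: "i \<in> set (block w s)"
  shows "hat w (w ! i) = (if Suc i \<in> set (block w s) then w ! Suc i else w ! s)"
proof -
  obtain e where e: "block w s = [s..<e]" "s < e" by (rule block_upt)
  have sub: "set (block w s) \<subseteq> {..<length w}"
    using s set_block by (auto simp: lr_max_def)
  let ?c = "map ((!) w) [s..<e]"
  have "inj_on ((!) w) {..<length w}"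
    using w by (auto simp: inj_on_def nth_eq_iff_index_eq)
  with sub have "inj_on ((!) w) (set [s..<e])"
    using e by (metis inj_on_subset)
  then have d: "distinct ?c" by (simp add: distinct_map)
  have ie: "s \<le> i" "i < e" using i e by auto
  then have "hat w (w ! i) = cycle_of_list ?c (?c ! (i - s))"
    using hat_block[OF assms] e by simp
  also have "\<dots> = ?c ! (Suc (i - s) mod length ?c)"
    using ie by (intro cycle_of_list_nth d) auto
  \<comment> \<open>Position \<open>i\<close> of the word is position \<open>i - s\<close> of the
    cycle, so the modulus wraps around exactly when \<open>i\<close> is the last index
    \<open>e - 1\<close>.\<close>
  also have "\<dots> = (if Suc i < e then w ! Suc i else w ! s)"
  proof (cases "Suc i < e")
    case True
    with ie have "Suc (i - s) mod (e - s) = Suc i - s" by (simp add: Suc_diff_le)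
    with True ie show ?thesis by simp
  next
    case False
    with ie have "Suc (i - s) = e - s" by auto
    with False e show ?thesis by simp
  qed
  finally show ?thesis using e ie by simp
qed

text \<open>Only the end of a block needs an argument, and there both sides fail: the image is the
  opening maximum, which is at least \<open>w ! i\<close>, and a following entry starts a new block
  and so exceeds \<open>w ! i\<close>.\<close>

lemma hat_descent_iff:
  assumes "distinct w" "i < length w" "b < w ! i"
  shows "hat w (w ! i) = b \<longleftrightarrow> Suc i < length w \<and> w ! Suc i = b"
proof -
  obtain s where s: "lr_max w s" and i: "i \<in> set (block w s)"
    using assms(2) by (rule ex_block)
  have sl: "s < length w" using s by (simp add: lr_max_def)
  note hat = hat_cases[OF assms(1) s i] and le = block_le_first[OF s i]
  show ?thesis
  proof (cases "Suc i \<in> set (block w s)")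
    case True
    then show ?thesis using hat set_block[OF sl] by simp
  next
    case False
    then have "lr_max w (Suc i)" if "Suc i < length w"
      using that i set_block[OF sl] by (metis le_SucE le_SucI)
    then have "w ! i < w ! Suc i" if "Suc i < length w"
      using that by (simp add: lr_max_def)
    with False hat le assms(3) show ?thesis by auto
  qed
qed

section \<open>Avoiding words\<close>

text \<open>For words with distinct entries this is avoidance of the pattern. The recursive form
  serves the induction on the prefix before the least letter; \<open>bottoms_min_nth\<close> links
  it to positions.\<close>

fun bottoms_min :: "'a::linorder list \<Rightarrow> bool" where
  "bottoms_min (c # b # w) \<longleftrightarrow> (b < c \<longrightarrow> (\<forall>a\<in>set w. b < a)) \<and> bottoms_min (b # w)"
| "bottoms_min _ \<longleftrightarrow> True"

lemma all_nat_iff: "(\<forall>i::nat. P i) \<longleftrightarrow> P 0 \<and> (\<forall>i. P (Suc i))"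
  by (metis nat.exhaust)

lemma bottoms_min_nth:
  "bottoms_min w \<longleftrightarrow>
     (\<forall>i j. Suc i < j \<and> j < length w \<and> w ! Suc i < w ! i \<longrightarrow> w ! Suc i < w ! j)"
proof (induction w rule: bottoms_min.induct)
  case (1 c b w)
  show ?case (is "_ \<longleftrightarrow> (\<forall>i j. ?Q i j)")
  proof -
    \<comment> \<open>Peeling off \<open>j = 0\<close> and \<open>j = 1\<close>, where
      \<open>Suc 0 < j\<close> fails, leaves exactly the indices of \<open>w\<close>.\<close>
    have "(\<forall>j. ?Q 0 j) \<longleftrightarrow> (b < c \<longrightarrow> (\<forall>a\<in>set w. b < a))"
      by (subst all_nat_iff, subst all_nat_iff) (auto simp: all_set_conv_all_nth)
    moreover have "(\<forall>j. ?Q (Suc i) j) \<longleftrightarrow> (\<forall>j. ?Q (Suc i) (Suc j))" for i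
      by (subst all_nat_iff) simp
    then have "(\<forall>i j. ?Q (Suc i) j) \<longleftrightarrow> bottoms_min (b # w)"
      unfolding 1 by simp
    ultimately show ?thesis
      by (subst all_nat_iff) simp
  qed
qed auto

lemma bottoms_min_Cons_less:
  "\<forall>a\<in>set v. m < a \<Longrightarrow> bottoms_min (m # v) \<longleftrightarrow> bottoms_min v"
  by (cases v) (auto dest: less_asym)

text \<open>A descent bottom inside \<open>u\<close> would have the smaller \<open>m\<close> to its
  right, so \<open>u\<close> has no descent. The step into \<open>m\<close> is harmless because
  \<open>m\<close> lies below all of \<open>v\<close>, and the step out of \<open>m\<close> is an
  ascent.\<close>

lemma bottoms_min_split:
  assumes "\<forall>a\<in>set u. m < a" "\<forall>a\<in>set v. m < a"
  shows "bottoms_min (u @ m # v) \<longleftrightarrow> sorted u \<and> bottoms_min v"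
  using assms
proof (induction u rule: induct_list012)
  case (3 x y u)
  then show ?case by (fastforce simp: not_less dest: less_asym)
qed (auto simp: bottoms_min_Cons_less)

section \<open>From the arrow pattern to descent bottoms\<close>

lemma ex_strict_mono_on_3:
  assumes "a < b" "b < (c::nat)"
  obtains x where "strict_mono_on {1..3::nat} x" "x 1 = a" "x 2 = b" "x 3 = c"
proof (rule that)
  let ?x = "\<lambda>k::nat. if k = 1 then a else if k = 2 then b else c"
  have "{1..3::nat} = {1, 2, 3}" by auto
  then show "strict_mono_on {1..3} ?x"
    using assms by (auto simp: strict_mono_on_def)
qed auto

text \<open>The dictionary is \<open>p = t 0\<close>, \<open>q = t 1\<close>, with
  \<open>w ! q\<close>, \<open>b\<close>, \<open>w ! p\<close> as \<open>x 1\<close>,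
  \<open>x 2\<close>, \<open>x 3\<close>; \<open>t\<close> counts from 0 and \<open>x\<close> from
  1.\<close>

lemma contains_31_32_iff:
  "contains_pattern w ([3, 1], {(3, 2)}) \<longleftrightarrow>
     (\<exists>p q b. p < q \<and> q < length w \<and> b \<in> set w \<and> w ! q < b \<and> b < w ! p \<and> hat w (w ! p) = b)"
  (is "?L \<longleftrightarrow> ?R")
proof
  have I: "{1..3::nat} = {1, 2, 3}" by auto
  assume ?L
  then obtain x t :: "nat \<Rightarrow> nat"
    where x: "strict_mono_on {1..3} x" "x ` {1..3} \<subseteq> set w"
      and t: "strict_mono_on {0..<length [3::nat, 1]} t"
      and tl: "\<forall>i<length [3::nat, 1]. t i < length w \<and> w ! t i = x ([3, 1] ! i)"
      and h: "hat w (x 3) = x 2"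
    unfolding contains_pattern_def pattern_size_31_32 fst_conv snd_conv by auto
  have "x 1 < x 2" "x 2 < x 3" "t 0 < t 1"
    using x(1) t by (auto simp: strict_mono_on_def)
  moreover have "t 0 < length w" "w ! t 0 = x 3" "t 1 < length w" "w ! t 1 = x 1"
    using tl[rule_format, of 0] tl[rule_format, of 1] by auto
  moreover have "x 2 \<in> set w" using x(2) I by auto
  ultimately show ?R using h by metis
next
  have I: "{1..3::nat} = {1, 2, 3}" "{0..<length [3::nat, 1]} = {0, 1}" by auto
  assume ?R
  then obtain p q b where pq: "p < q" "q < length w" "b \<in> set w" "w ! q < b" "b < w ! p"
    "hat w (w ! p) = b" by blast
  obtain x where x: "strict_mono_on {1..3::nat} x" "x 1 = w ! q" "x 2 = b" "x 3 = w ! p"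
    using ex_strict_mono_on_3[OF pq(4,5)] by metis
  let ?t = "\<lambda>k::nat. if k = 0 then p else q"
  have "strict_mono_on {0..<length [3::nat, 1]} ?t"
    using pq(1) unfolding I by (auto simp: strict_mono_on_def)
  moreover have "x ` {1..3} \<subseteq> set w"
    using pq unfolding I by (simp add: x del: One_nat_def)
  moreover have "\<forall>i<length [3::nat, 1]. ?t i < length w \<and> w ! ?t i = x ([3, 1] ! i)"
    using pq x by (auto simp: less_Suc_eq)
  moreover have "\<forall>(b, c)\<in>{(3, 2)}. hat w (x b) = x c"
    using pq x by simp
  ultimately show ?L
    unfolding contains_pattern_def pattern_size_31_32 fst_conv snd_conv using x(1) by blast
qed

lemma contains_31_32_iff_bottoms_min:
  assumes "distinct w"
  shows "contains_pattern w ([3, 1], {(3, 2)}) \<longleftrightarrow> \<not> bottoms_min w"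
proof -
  \<comment> \<open>Since \<open>b < w ! p\<close>, \<open>hat_descent_iff\<close> forces
    \<open>b = w ! Suc p\<close>, which eliminates both \<open>b\<close> and
    \<open>hat\<close>.\<close>
  have "contains_pattern w ([3, 1], {(3, 2)}) \<longleftrightarrow>
      (\<exists>p q. p < q \<and> q < length w \<and> w ! q < w ! Suc p \<and> w ! Suc p < w ! p)"
    unfolding contains_31_32_iff
  proof (intro iffI; elim exE conjE)
    fix p q b assume "p < q" "q < length w" "w ! q < b" "b < w ! p" "hat w (w ! p) = b"
    with hat_descent_iff[OF assms, of p b]
    show "\<exists>p q. p < q \<and> q < length w \<and> w ! q < w ! Suc p \<and> w ! Suc p < w ! p"
      by (metis less_trans)
  next
    fix p q assume "p < q" "q < length w" "w ! q < w ! Suc p" "w ! Suc p < w ! p"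
    with hat_descent_iff[OF assms, of p "w ! Suc p"]
    show "\<exists>p q b. p < q \<and> q < length w \<and> b \<in> set w \<and> w ! q < b \<and> b < w ! p \<and> hat w (w ! p) = b"
      by (intro exI[of _ p] exI[of _ q] exI[of _ "w ! Suc p"]) auto
  qed
  also have "\<dots> \<longleftrightarrow>
      (\<exists>p q. Suc p < q \<and> q < length w \<and> w ! Suc p < w ! p \<and> \<not> w ! Suc p < w ! q)"
  proof -
    \<comment> \<open>For \<open>q = Suc p\<close> both sides are false; for any other
      \<open>q\<close> distinctness rules out equal entries.\<close>
    have "p < q \<and> w ! q < w ! Suc p \<longleftrightarrow> Suc p < q \<and> \<not> w ! Suc p < w ! q"
      if "q < length w" for p q
      using that nth_eq_iff_index_eq[OF assms, of q "Suc p"]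
      by (cases "q = Suc p") (auto simp: not_less le_less)
    then show ?thesis by blast
  qed
  also have "\<dots> \<longleftrightarrow> \<not> bottoms_min w"
    unfolding bottoms_min_nth by blast
  finally show ?thesis .
qed

section \<open>Splitting at the least element\<close>

text \<open>Arbitrary sets of letters are allowed because deleting the letters of a prefix from an
  interval need not leave an interval.\<close>

definition bottoms_min_words :: "'a::linorder set \<Rightarrow> 'a list set" where
  "bottoms_min_words A = {w \<in> permutations_of_set A. bottoms_min w}"

lemma finite_bottoms_min_words: "finite (bottoms_min_words A)"
  by (auto simp: bottoms_min_words_def intro: finite_subset[OF _ finite_permutations_of_set])

text \<open>\<open>U\<close> is the set of letters before \<open>m\<close>. By
  \<open>bottoms_min_split\<close> the prefix is increasing, hence determined by \<open>U\<close>,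
  while the suffix is any word of the same kind on \<open>A - U\<close>.\<close>

lemma bottoms_min_words_split:
  assumes A: "finite A" and m: "m \<notin> A" "\<forall>a\<in>A. m < a"
  shows "bottoms_min_words (insert m A) =
    (\<Union>U\<in>Pow A. (\<lambda>v. sorted_list_of_set U @ m # v) ` bottoms_min_words (A - U))"
proof (intro set_eqI iffI)
  fix w assume "w \<in> bottoms_min_words (insert m A)"
  then have w: "set w = insert m A" "distinct w" "bottoms_min w"
    by (auto simp: bottoms_min_words_def permutations_of_set_def)
  then obtain u v where uv: "w = u @ m # v"
    by (metis insertI1 split_list)
  have "set u \<union> set v = A"
    using w m(1) uv by auto
  moreover from this have "sorted u" "bottoms_min v"
    using bottoms_min_split[of u m v] m w uv by auto
  ultimately have u: "set u \<in> Pow A" "sorted u" "distinct u"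
    and v: "v \<in> bottoms_min_words (A - set u)"
    using w(2) uv by (auto simp: bottoms_min_words_def permutations_of_set_def)
  from u(2,3) have "w = sorted_list_of_set (set u) @ m # v"
    unfolding uv by (simp add: sorted_list_of_set.idem_if_sorted_distinct)
  with u(1) v show "w \<in> (\<Union>U\<in>Pow A. (\<lambda>v. sorted_list_of_set U @ m # v) ` bottoms_min_words (A - U))"
    by (intro UN_I[of "set u"] image_eqI[of _ _ v])
next
  fix w assume "w \<in> (\<Union>U\<in>Pow A. (\<lambda>v. sorted_list_of_set U @ m # v) ` bottoms_min_words (A - U))"
  then obtain U v where U: "U \<subseteq> A" and v: "v \<in> bottoms_min_words (A - U)"
    and w: "w = sorted_list_of_set U @ m # v" by auto
  have "finite U" using U A finite_subset by blast
  moreover from v have v': "set v = A - U" "distinct v" "bottoms_min v"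
    by (auto simp: bottoms_min_words_def permutations_of_set_def)
  ultimately have "bottoms_min w"
    unfolding w using U m by (subst bottoms_min_split) auto
  then show "w \<in> bottoms_min_words (insert m A)"
    using w v' U m \<open>finite U\<close> by (auto simp: bottoms_min_words_def permutations_of_set_def)
qed

text \<open>Here \<open>U\<close> is the block of \<open>m\<close> without \<open>m\<close>. The
  index set \<open>Pow A\<close> and the remainders \<open>A - U\<close> match those for
  words.\<close>

lemma partitions_split:
  assumes m: "m \<notin> A"
  shows "{P. partition_on (insert m A) P} =
    (\<Union>U\<in>Pow A. insert (insert m U) ` {P. partition_on (A - U) P})"
proof (intro set_eqI iffI)
  fix P assume "P \<in> {P. partition_on (insert m A) P}"
  then have P: "partition_on (insert m A) P" by simp
  then obtain B where B: "B \<in> P" "m \<in> B"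
    by (metis UnionE insertI1 partition_onD1)
  define U where "U = B - {m}"
  have BU: "B = insert m U" using B by (auto simp: U_def)
  have "U \<subseteq> A" using partition_onD1[OF P] B by (auto simp: U_def)
  moreover have "partition_on (A - U) (P - {B})"
  proof -
    have "\<Union> (P - {B}) = insert m A - B"
      using partition_onD1[OF P] partition_onD2[OF P] B
      by (auto simp: disjoint_def)
    also have "\<dots> = A - U" using m B by (auto simp: U_def)
    finally show ?thesis
      using P by (auto simp: partition_on_def disjoint_def)
  qed
  moreover have "P = insert (insert m U) (P - {B})" using B BU by auto
  ultimately show "P \<in> (\<Union>U\<in>Pow A. insert (insert m U) ` {P. partition_on (A - U) P})" by blast
next
  fix P assume "P \<in> (\<Union>U\<in>Pow A. insert (insert m U) ` {P. partition_on (A - U) P})"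
  then obtain U Q where U: "U \<subseteq> A" and Q: "partition_on (A - U) Q"
    and P: "P = insert (insert m U) Q" by auto
  have "partition_on (insert m A) P"
    unfolding P
  proof (rule partition_onI)
    show "\<Union> (insert (insert m U) Q) = insert m A"
      using U partition_onD1[OF Q] by auto
  next
    fix p q assume "p \<in> insert (insert m U) Q" "q \<in> insert (insert m U) Q" "p \<noteq> q"
    moreover have "disjnt (insert m U) q" if "q \<in> Q" for q
      using that partition_onD1[OF Q] m by (auto simp: disjnt_def)
    ultimately show "disjnt p q"
      using partition_onD2[OF Q] by (auto simp: disjoint_def disjnt_def)
  qed (use partition_onD3[OF Q] in auto)
  then show "P \<in> {P. partition_on (insert m A) P}" by simp
qed

section \<open>The common recursion and the count\<close>

lemma card_partitions_split:
  assumes "finite A" "m \<notin> A"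
  shows "card {P. partition_on (insert m A) P} =
    (\<Sum>U\<in>Pow A. card {P. partition_on (A - U) P})"
proof -
  \<comment> \<open>No block of a partition of \<open>A - V\<close> contains \<open>m\<close>. This
    makes the families for different \<open>U\<close> disjoint and adding the block of
    \<open>m\<close> injective.\<close>
  have fresh: "insert m U \<notin> P" if "partition_on (A - V) P" for U V P
    using partition_onD1[OF that] assms(2) by auto
  have "card {P. partition_on (insert m A) P} =
      (\<Sum>U\<in>Pow A. card (insert (insert m U) ` {P. partition_on (A - U) P}))"
    unfolding partitions_split[OF assms(2)]
  proof (rule card_UN_disjoint)
    show "\<forall>U\<in>Pow A. finite (insert (insert m U) ` {P. partition_on (A - U) P})"
      using assms(1) by (auto intro!: finitely_many_partition_on)
    show "\<forall>U\<in>Pow A. \<forall>V\<in>Pow A. U \<noteq> V \<longrightarrow>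
        insert (insert m U) ` {P. partition_on (A - U) P} \<inter>
        insert (insert m V) ` {P. partition_on (A - V) P} = {}"
    proof (intro ballI impI equals0I)
      fix U V R assume UV: "U \<in> Pow A" "V \<in> Pow A" "U \<noteq> V"
        and R: "R \<in> insert (insert m U) ` {P. partition_on (A - U) P} \<inter>
          insert (insert m V) ` {P. partition_on (A - V) P}"
      from IntD1[OF R] have "insert m U \<in> R" by (rule imageE) simp
      moreover from IntD2[OF R] obtain P
        where P: "R = insert (insert m V) P" "P \<in> {P. partition_on (A - V) P}"
        by (rule imageE)
      ultimately have "insert m U \<in> insert (insert m V) P" by simp
      moreover from P(2) have "insert m U \<notin> P" by (intro fresh) simp
      ultimately have "insert m U = insert m V" by simp
      with UV assms(2) show False by auto
    qed
  qed (use assms in simp)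
  also have "\<dots> = (\<Sum>U\<in>Pow A. card {P. partition_on (A - U) P})"
  proof (intro sum.cong refl card_image inj_onI)
    fix U P Q
    assume "P \<in> {P. partition_on (A - U) P}" "Q \<in> {P. partition_on (A - U) P}"
      and "insert (insert m U) P = insert (insert m U) Q"
    moreover from this have "insert m U \<notin> P" "insert m U \<notin> Q"
      by (auto dest: fresh)
    ultimately show "P = Q" by (metis insert_ident)
  qed
  finally show ?thesis .
qed

lemma card_bottoms_min_words_split:
  assumes "finite A" "m \<notin> A" "\<forall>a\<in>A. m < a"
  shows "card (bottoms_min_words (insert m A)) =
    (\<Sum>U\<in>Pow A. card (bottoms_min_words (A - U)))"
proof -
  have "card (bottoms_min_words (insert m A)) =
      (\<Sum>U\<in>Pow A. card ((\<lambda>v. sorted_list_of_set U @ m # v) ` bottoms_min_words (A - U)))"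
    unfolding bottoms_min_words_split[OF assms]
  proof (rule card_UN_disjoint)
    show "\<forall>U\<in>Pow A. \<forall>V\<in>Pow A. U \<noteq> V \<longrightarrow>
        (\<lambda>v. sorted_list_of_set U @ m # v) ` bottoms_min_words (A - U) \<inter>
        (\<lambda>v. sorted_list_of_set V @ m # v) ` bottoms_min_words (A - V) = {}"
    proof (intro ballI impI equals0I)
      fix U V w assume UV: "U \<in> Pow A" "V \<in> Pow A" "U \<noteq> V"
        and "w \<in> (\<lambda>v. sorted_list_of_set U @ m # v) ` bottoms_min_words (A - U) \<inter>
          (\<lambda>v. sorted_list_of_set V @ m # v) ` bottoms_min_words (A - V)"
      then obtain u v where "sorted_list_of_set U @ m # u = sorted_list_of_set V @ m # v"
        and "u \<in> bottoms_min_words (A - U)"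
        by blast
      moreover have "finite U" "finite V" "m \<notin> U" "m \<notin> V"
        using UV assms by (auto intro: finite_subset)
      moreover from this have "m \<notin> set (sorted_list_of_set U)" "m \<notin> set (sorted_list_of_set V)"
        by simp_all
      \<comment> \<open>As \<open>m\<close> occurs in neither prefix nor in \<open>u\<close>, its
        position in the common word is unique, so the prefixes agree and hence
        \<open>U = V\<close>.\<close>
      moreover have "m \<notin> set u"
        using calculation(2) assms(2) by (auto simp: bottoms_min_words_def permutations_of_set_def)
      ultimately have "sorted_list_of_set U = sorted_list_of_set V"
        by (metis append_Cons_eq_iff)
      with \<open>finite U\<close> \<open>finite V\<close> UV(3) show False
        using sorted_list_of_set_inject by blast
    qed
  qed (use assms in \<open>auto simp: finite_bottoms_min_words\<close>)
  also have "\<dots> = (\<Sum>U\<in>Pow A. card (bottoms_min_words (A - U)))"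
    by (intro sum.cong refl card_image inj_onI) simp
  finally show ?thesis .
qed

text \<open>Both counts obey the same recursion over subsets once the least element is split off.
  The remainders \<open>A' - U\<close> can be any subsets of \<open>A'\<close>, hence the induction
  over all proper subsets.\<close>

lemma card_bottoms_min_words:
  assumes "finite A"
  shows "card (bottoms_min_words A) = card {P. partition_on A P}"
  using assms
proof (induction A rule: finite_psubset_induct)
  case (psubset A)
  show ?case
  proof (cases "A = {}")
    case True
    have "bottoms_min_words ({} :: 'a set) = {[]}"
      by (auto simp: bottoms_min_words_def)
    then show ?thesis using True by (simp add: partition_on_empty)
  next
    case False
    define m A' where "m = Min A" and "A' = A - {m}"
    have "m \<in> A"
      unfolding m_def using psubset.hyps False by (rule Min_in)
    then have A: "A = insert m A'"
      unfolding A'_def by blast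
    have m: "m \<notin> A'" "\<forall>a\<in>A'. m < a" and fin: "finite A'"
      using psubset.hyps by (auto simp: m_def A'_def less_le)
    have "card (bottoms_min_words (A' - U)) = card {P. partition_on (A' - U) P}" for U
      by (rule psubset.IH) (use A m in blast)
    then show ?thesis
      unfolding A card_bottoms_min_words_split[OF fin m] card_partitions_split[OF fin m(1)]
      by simp
  qed
qed

theorem theorem4p3:
  fixes n :: nat
  assumes "n \<ge> 1"
  shows "card (avoiders n ([3, 1], {(3, 2)})) = Bell n"
proof -
  have "avoiders n ([3, 1], {(3, 2)}) = bottoms_min_words {1..n}"
    using contains_31_32_iff_bottoms_min
    by (auto simp: avoiders_def bottoms_min_words_def permutations_of_set_def)
  then show ?thesis
    by (simp add: card_bottoms_min_words Bell_def)
qed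

end
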